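(* There are topological dynamical systems with the vague specification property but without the weak specification property.
   Context: $\mathbb{N}_0=\{0,1,2,\ldots\}$, $\mathbb{N}=\{1,2,\ldots\}$. A topological dynamical system $(X,T)$ consists of a compact metrizable space $X$ and a continuous map $T\colon X\to X$. Fix a compatible metric $\rho$ on $X$ of diameter at most $1$ (the notions below do not depend on this choice). Weak specification property: for every $\varepsilon>0$ there is a nondecreasing function $M_\varepsilon\colon\mathbb{N}\to\mathbb{N}$ with $M_\varepsilon(n)/n\to0$ as $n\to\infty$ such that for every $k\in\mathbb{N}$, all points $x_1,\ldots,x_k\in X$ and all integers $0\le a_1\le b_1<a_2\le b_2<\cdots<a_k\le b_k$ with $a_i-b_{i-1}\ge M_\varepsilon(b_i-a_i+1)$ for $2\le i\le k$, there is $y\in X$ with $\rho(T^j(y),T^j(x_i))\le\varepsilon$ for all $1\le i\le k$ and $a_i\le j\le b_i$. For $A\subseteq\mathbb{N}_0$ we write $d(A)=1$ if $\lim_{n\to\infty}\frac{|A\cap[0,n)|}{n}=1$. $X^\infty$ is the set of all sequences $\underline{x}=\{x_n\}_{n=0}^\infty$ in $X$, with the product topology; $S(\underline{x})=\{x_{n+1}\}_{n=0}^\infty$ is the shift on $X^\infty$. Let $\Gamma_T=\{\{T^n(z)\}_{n=0}^\infty : z\in X\}\subseteq X^\infty$. Vague pseudo-orbit: $\underline{x}\in X^\infty$ such that for every open set $\mathcal{U}\subseteq X^\infty$ containing $\Gamma_T$ one has $d(\{n\in\mathbb{N}_0 : S^n(\underline{x})\in\mathcal{U}\})=1$. Vague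 specification property: for every vague pseudo-orbit $\underline{x}$ in $(X,T)$ there is $z\in X$ such that for every $\varepsilon>0$, $d(\{n\in\mathbb{N}_0 : \rho(T^n(z),x_n)<\varepsilon\})=1$. *)

theory Defs
  imports "HOL-Analysis.Analysis"
begin

definition tds :: "'a topology \<Rightarrow> ('a \<Rightarrow> 'a) \<Rightarrow> bool" where
  "tds X T \<longleftrightarrow> compact_space X \<and> metrizable_space X \<and> continuous_map X X T"

text \<open>The locale \<^locale>\<open>Metric_space\<close> also asks for symmetry and nonnegativity of \<open>\<rho>\<close> off the
  carrier; such values are never used below.\<close>

definition compatible_metric :: "'a topology \<Rightarrow> ('a \<Rightarrow> 'a \<Rightarrow> real) \<Rightarrow> bool" where
  "compatible_metric X \<rho> \<longleftrightarrow>
     Metric_space (topspace X) \<rho> \<and>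
     Metric_space.mtopology (topspace X) \<rho> = X \<and>
     (\<forall>x\<in>topspace X. \<forall>y\<in>topspace X. \<rho> x y \<le> 1)"

lemma compatible_metric_exists:
  assumes "metrizable_space X"
  shows "\<exists>\<rho>. compatible_metric X \<rho>"
proof -
  obtain M d where M: "Metric_space M d" and X: "X = Metric_space.mtopology M d"
    using assms unfolding metrizable_space_def by blast
  define m where "m = capped_metric 1 (metric (M, d))"
  have "mtopology_of m = mtopology_of (metric (M, d))"
    unfolding m_def by (rule mtopology_capped_metric)
  also have "\<dots> = X"
    by (simp add: X M mtopology_of_def Metric_space.mspace_metric Metric_space.mdist_metric)
  finally have m: "mtopology_of m = X" .
  have X': "topspace X = mspace m"
    using m topspace_mtopology_of by metis
  have "Metric_space (mspace m) (mdist m)" "Metric_space.mtopology (mspace m) (mdist m) = X"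
    using m by (auto simp: mtopology_of_def)
  moreover have "mdist m x y \<le> 1" for x y
    by (simp add: m_def mdist_capped)
  ultimately have "compatible_metric X (mdist m)"
    unfolding compatible_metric_def X' by blast
  then show ?thesis by blast
qed

text \<open>The gap function \<open>M\<close> takes values in, and is only constrained on, the positive integers.  The natural
  number subtractions below do not truncate, because \<open>b (i - 1) < a i\<close> and \<open>a i \<le> b i\<close>.\<close>

definition weak_specification ::
    "'a topology \<Rightarrow> ('a \<Rightarrow> 'a) \<Rightarrow> ('a \<Rightarrow> 'a \<Rightarrow> real) \<Rightarrow> bool" where
  "weak_specification X T \<rho> \<longleftrightarrow>
     (\<forall>\<epsilon>>0. \<exists>M :: nat \<Rightarrow> nat.
        (\<forall>n\<ge>1. M n \<ge> 1) \<and> mono_on {1..} M \<and> (\<lambda>n. real (M n) / real n) \<longlonglongrightarrow> 0 \<and>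
        (\<forall>k\<ge>1. \<forall>(x :: nat \<Rightarrow> 'a) (a :: nat \<Rightarrow> nat) (b :: nat \<Rightarrow> nat).
           (\<forall>i\<in>{1..k}. x i \<in> topspace X) \<and>
           (\<forall>i\<in>{1..k}. a i \<le> b i) \<and>
           (\<forall>i\<in>{2..k}. b (i - 1) < a i) \<and>
           (\<forall>i\<in>{2..k}. a i - b (i - 1) \<ge> M (b i - a i + 1))
           \<longrightarrow> (\<exists>y\<in>topspace X. \<forall>i\<in>{1..k}. \<forall>j\<in>{a i..b i}.
                  \<rho> ((T ^^ j) y) ((T ^^ j) (x i)) \<le> \<epsilon>)))"

definition density_one :: "nat set \<Rightarrow> bool" where
  "density_one A \<longleftrightarrow> (\<lambda>n. real (card (A \<inter> {0..<n})) / real n) \<longlonglongrightarrow> 1"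

abbreviation seq_space :: "'a topology \<Rightarrow> (nat \<Rightarrow> 'a) topology" where
  "seq_space X \<equiv> product_topology (\<lambda>_. X) UNIV"

definition seq_shift :: "(nat \<Rightarrow> 'a) \<Rightarrow> nat \<Rightarrow> 'a" where
  "seq_shift x = (\<lambda>n. x (Suc n))"

definition orbit_set :: "'a topology \<Rightarrow> ('a \<Rightarrow> 'a) \<Rightarrow> (nat \<Rightarrow> 'a) set" where
  "orbit_set X T = (\<lambda>z n. (T ^^ n) z) ` topspace X"

definition vague_pseudo_orbit ::
    "'a topology \<Rightarrow> ('a \<Rightarrow> 'a) \<Rightarrow> (nat \<Rightarrow> 'a) \<Rightarrow> bool" where
  "vague_pseudo_orbit X T x \<longleftrightarrow>
     x \<in> topspace (seq_space X) \<and>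
     (\<forall>U. openin (seq_space X) U \<and> orbit_set X T \<subseteq> U
        \<longrightarrow> density_one {n. (seq_shift ^^ n) x \<in> U})"

definition vague_specification ::
    "'a topology \<Rightarrow> ('a \<Rightarrow> 'a) \<Rightarrow> ('a \<Rightarrow> 'a \<Rightarrow> real) \<Rightarrow> bool" where
  "vague_specification X T \<rho> \<longleftrightarrow>
     (\<forall>x. vague_pseudo_orbit X T x \<longrightarrow>
        (\<exists>z\<in>topspace X. \<forall>\<epsilon>>0. density_one {n. \<rho> ((T ^^ n) z) (x n) < \<epsilon>}))"

text \<open>HOL cannot quantify existentially over types, so an existence claim about compact metrizable
  spaces needs a fixed underlying type.  The type \<^typ>\<open>real topology\<close> loses no generality: it consists
  of all abstract topologies (not just subspaces of the Euclidean line) on arbitrary sets of reals, and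
  compact metrizable spaces have at most continuum many points, so each of them is homeomorphic
  to one of this type.\<close>

end

theory Submission
  imports Defs
begin

text \<open>
  The witness is the tent map on the invariant set \<open>{0} \<union> {2\<^sup>-\<^sup>n : n \<ge> 0}\<close>: the point \<open>2\<^sup>-\<^sup>n\<close> climbs
  to the isolated point \<open>1\<close> in exactly \<open>n\<close> steps and then drops to the fixed point \<open>0\<close>.
  Weak specification fails because no orbit visits \<open>1\<close> twice, whereas \<open>1\<close> has preimages of every order.
  The vague specification property holds because every orbit spends only a bounded window of time
  outside a given neighbourhood of \<open>0\<close>; this is an open condition on initial segments, so a vague
  pseudo-orbit converges to \<open>0\<close> along a set of density one and is traced by \<open>0\<close> itself.
\<close>

section \<open>Sets of density one and sliding windows\<close>

text \<open>Passing to the complement turns the lower bound on a density into an upper bound on a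
  count of exceptions, which suits monotonicity and double counting.\<close>

lemma density_one_iff:
  "density_one A \<longleftrightarrow> (\<lambda>n. real (card ({0..<n} - A)) / real n) \<longlonglongrightarrow> 0"
proof -
  \<comment> \<open>At \<open>n = 0\<close> division by zero makes the left side 0 and the right
    side 1, so the two sequences agree only eventually.\<close>
  have eq: "real (card (A \<inter> {0..<n})) / real n = 1 - real (card ({0..<n} - A)) / real n"
    if "n > 0" for n
  proof -
    have "card (A \<inter> {0..<n}) + card ({0..<n} - A) = n"
      using card_Int_Diff[of "{0..<n}" A] by (simp add: Int_commute)
    then have "real (card (A \<inter> {0..<n})) = real n - real (card ({0..<n} - A))"
      by linarith
    then show ?thesis using that by (simp add: field_simps)
  qed
  have "density_one A \<longleftrightarrow> (\<lambda>n. 1 - real (card ({0..<n} - A)) / real n) \<longlonglongrightarrow> 1"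
    unfolding density_one_def
    by (rule tendsto_cong, use eventually_gt_at_top[of 0] in eventually_elim) (simp add: eq)
  also have "\<dots> \<longleftrightarrow> (\<lambda>n. real (card ({0..<n} - A)) / real n) \<longlonglongrightarrow> 0"
    using tendsto_diff[of "\<lambda>_. 1::real" 1 sequentially
        "\<lambda>n. 1 - real (card ({0..<n} - A)) / real n" 1]
      tendsto_diff[of "\<lambda>_. 1::real" 1 sequentially
        "\<lambda>n. real (card ({0..<n} - A)) / real n" 0]
    by auto
  finally show ?thesis .
qed

lemma density_one_mono:
  assumes "density_one A" "A \<subseteq> B"
  shows "density_one B"
  unfolding density_one_iff
proof (rule tendsto_sandwich[OF _ _ tendsto_const])
  show "(\<lambda>n. real (card ({0..<n} - A)) / real n) \<longlonglongrightarrow> 0"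
    using assms(1) by (simp add: density_one_iff)
  show "\<forall>\<^sub>F n in sequentially. real (card ({0..<n} - B)) / real n
      \<le> real (card ({0..<n} - A)) / real n"
    using assms(2) by (intro always_eventually allI divide_right_mono) (auto intro!: card_mono)
qed auto

text \<open>Double counting of the pairs \<open>(n, j)\<close> with \<open>n < m\<close>, \<open>j < N\<close> and \<open>n + j \<notin> A\<close>.\<close>

lemma card_le_window_count:
  fixes A :: "nat set"
  shows "N * card ({0..<m} - A) \<le>
    K * m + N * card ({0..<m} - {n. card {j \<in> {..<N}. n + j \<notin> A} \<le> K}) + N * N"
proof -
  define w where "w n = card {j \<in> {..<N}. n + j \<notin> A}" for n
  have w_le: "w n \<le> N" for n
    using card_mono[of "{..<N}" "{j \<in> {..<N}. n + j \<notin> A}"] by (auto simp: w_def)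
  \<comment> \<open>An exception \<open>b \<ge> N\<close> is \<open>n + j\<close> with
    \<open>n = b - j\<close> a genuine difference; the summand \<open>N\<close> absorbs the
    exceptions below \<open>N\<close>.\<close>
  have shift: "card ({0..<m} - A) \<le> card {n \<in> {0..<m}. n + j \<notin> A} + N" if "j < N" for j
  proof -
    have "{0..<m} - A \<subseteq> (\<lambda>n. n + j) ` {n \<in> {0..<m}. n + j \<notin> A} \<union> {0..<N}"
    proof
      fix b assume b: "b \<in> {0..<m} - A"
      show "b \<in> (\<lambda>n. n + j) ` {n \<in> {0..<m}. n + j \<notin> A} \<union> {0..<N}"
      proof (cases "b < N")
        case False
        then have "b = (b - j) + j" "b - j \<in> {n \<in> {0..<m}. n + j \<notin> A}"
          using that b by auto
        then show ?thesis by blast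
      qed auto
    qed
    then have "card ({0..<m} - A) \<le> card ((\<lambda>n. n + j) ` {n \<in> {0..<m}. n + j \<notin> A} \<union> {0..<N})"
      by (intro card_mono) auto
    also have "\<dots> \<le> card ((\<lambda>n. n + j) ` {n \<in> {0..<m}. n + j \<notin> A}) + card {0..<N}"
      by (rule card_Un_le)
    also have "\<dots> \<le> card {n \<in> {0..<m}. n + j \<notin> A} + N"
      by (simp add: card_image_le)
    finally show ?thesis .
  qed
  have count: "card {i \<in> I. P i} = (\<Sum>i\<in>I. of_bool (P i))" if "finite I" for I :: "nat set" and P
    using that by (simp add: sum.If_cases Int_def of_bool_def)
  have "N * card ({0..<m} - A) \<le> (\<Sum>j<N. card {n \<in> {0..<m}. n + j \<notin> A} + N)"
    using sum_mono[of "{..<N}" "\<lambda>_. card ({0..<m} - A)"] shift by simp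
  also have "\<dots> = (\<Sum>j<N. \<Sum>n\<in>{0..<m}. of_bool (n + j \<notin> A)) + N * N"
    by (simp only: sum.distrib count[OF finite_atLeastLessThan] sum_constant card_lessThan of_nat_id)
  also have "\<dots> = (\<Sum>n\<in>{0..<m}. w n) + N * N"
    by (subst sum.swap) (simp only: w_def[abs_def] count[OF finite_lessThan])
  \<comment> \<open>A good window contributes at most \<open>K\<close>, a bad one at most its full
    length \<open>N\<close>.\<close>
  also have "(\<Sum>n\<in>{0..<m}. w n) \<le> (\<Sum>n\<in>{0..<m}. K + N * of_bool (\<not> w n \<le> K))"
    using w_le by (intro sum_mono) (auto intro: trans_le_add2)
  also have "\<dots> = K * m + N * card ({0..<m} - {n. w n \<le> K})"
  proof -
    have "{0..<m} - {n. w n \<le> K} = {n \<in> {0..<m}. \<not> w n \<le> K}"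
      by auto
    then show ?thesis
      by (simp only: sum.distrib count[OF finite_atLeastLessThan] sum_distrib_left[symmetric]) simp
  qed
  finally show ?thesis
    unfolding w_def by simp
qed

text \<open>Dividing the window count by \<open>N * m\<close> bounds the proportion of exceptions by
  \<open>K / N\<close> plus terms that vanish as \<open>m\<close> grows. Since \<open>K\<close> is
  the same for every window length, \<open>N\<close> can be chosen with \<open>K / N\<close> below
  any given \<open>e\<close>.\<close>

lemma density_one_if_sparse_windows:
  assumes "\<And>N. density_one {n. card {j \<in> {..<N}. n + j \<notin> A} \<le> K}"
  shows "density_one A"
  unfolding density_one_iff
proof (rule order_tendstoI)
  fix e :: real
  assume "e > 0"
  obtain N :: nat where N: "real K / e < real N"
    using reals_Archimedean2 by blast
  moreover have "0 \<le> real K / e" using \<open>e > 0\<close> by simp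
  ultimately have "N > 0" by linarith
  define G where "G = {n. card {j \<in> {..<N}. n + j \<notin> A} \<le> K}"
  have "(\<lambda>m. real (card ({0..<m} - G)) / real m) \<longlonglongrightarrow> 0"
    using assms[of N] by (simp add: density_one_iff G_def)
  then have "(\<lambda>m. real K / real N + real (card ({0..<m} - G)) / real m + real N / real m)
      \<longlonglongrightarrow> real K / real N + 0 + 0"
    by (intro tendsto_add tendsto_const lim_const_over_n)
  moreover have "real K / real N + 0 + 0 < e"
    using N \<open>N > 0\<close> \<open>e > 0\<close> by (simp add: field_simps)
  ultimately have "\<forall>\<^sub>F m in sequentially.
      real K / real N + real (card ({0..<m} - G)) / real m + real N / real m < e"
    by (rule order_tendstoD(2))
  then show "\<forall>\<^sub>F m in sequentially. real (card ({0..<m} - A)) / real m < e"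
    using eventually_gt_at_top[of 0]
  proof eventually_elim
    case (elim m)
    have "real (N * card ({0..<m} - A)) \<le> real (K * m + N * card ({0..<m} - G) + N * N)"
      using card_le_window_count[of N m A K] unfolding G_def of_nat_le_iff .
    then have "real (card ({0..<m} - A)) / real m
        \<le> real K / real N + real (card ({0..<m} - G)) / real m + real N / real m"
      using \<open>N > 0\<close> elim(2) by (simp add: field_simps)
    then show ?case using elim(1) by linarith
  qed
next
  fix e :: real
  assume "e < 0"
  then show "\<forall>\<^sub>F n in sequentially. e < real (card ({0..<n} - A)) / real n"
    by (intro always_eventually allI) (rule less_le_trans, auto)
qed

section \<open>Vague specification from bounded escape\<close>

lemma funpow_seq_shift: "(seq_shift ^^ n) x j = x (n + j)"
  by (induction n arbitrary: j) (auto simp: seq_shift_def)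

lemma funpow_fixpoint: "T p = p \<Longrightarrow> (T ^^ n) p = p"
  by (induction n) auto

lemma funpow_in_topspace:
  "\<lbrakk>continuous_map X X T; z \<in> topspace X\<rbrakk> \<Longrightarrow> (T ^^ n) z \<in> topspace X"
  by (induction n) (auto simp: continuous_map_def)

lemma openin_seq_space_cylinder:
  assumes "openin X V" "finite J"
  shows "openin (seq_space X) {x \<in> topspace (seq_space X). \<forall>j\<in>J. x j \<in> V}"
proof -
  have "openin (seq_space X) (PiE UNIV (\<lambda>j. if j \<in> J then V else topspace X))"
    using assms by (intro product_topology_basis) (auto intro: finite_subset[OF _ assms(2)])
  also have "PiE UNIV (\<lambda>j. if j \<in> J then V else topspace X)
      = {x \<in> topspace (seq_space X). \<forall>j\<in>J. x j \<in> V}"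
    using openin_subset[OF assms(1)]
    by (fastforce simp: PiE_iff split: if_splits)
  finally show ?thesis .
qed

text \<open>The fixed point \<open>p\<close> itself traces every vague pseudo-orbit. The bound
  \<open>K\<close> is uniform over all orbits, so it passes to almost all windows of a vague
  pseudo-orbit, whatever their length, and the window criterion applies.\<close>

lemma vague_specification_if_bounded_escape:
  assumes T: "continuous_map X X T"
    and \<rho>: "compatible_metric X \<rho>"
    and p: "p \<in> topspace X" "T p = p"
    and escape: "\<And>V. \<lbrakk>openin X V; p \<in> V\<rbrakk> \<Longrightarrow>
      \<exists>K. \<forall>z\<in>topspace X. \<exists>i. \<forall>k. k \<notin> {i..<i+K} \<longrightarrow> (T ^^ k) z \<in> V"
  shows "vague_specification X T \<rho>"
  unfolding vague_specification_def
proof (intro allI impI bexI[OF _ p(1)])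
  fix x and \<epsilon> :: real
  assume x: "vague_pseudo_orbit X T x" and "\<epsilon> > 0"
  interpret Metric_space "topspace X" \<rho>
    using \<rho> by (simp add: compatible_metric_def)
  have top: "mtopology = X"
    using \<rho> by (simp add: compatible_metric_def)
  define V where "V = mball p \<epsilon>"
  have V: "openin X V" "p \<in> V"
    using openin_mball[of p \<epsilon>] p(1) \<open>\<epsilon> > 0\<close> by (auto simp: V_def top)
  obtain K where K: "\<And>z. z \<in> topspace X \<Longrightarrow> \<exists>i. \<forall>k. k \<notin> {i..<i+K} \<longrightarrow> (T ^^ k) z \<in> V"
    using escape[OF V] by blast
  have "density_one {n. card {j \<in> {..<N}. n + j \<notin> {n. x n \<in> V}} \<le> K}" for N
  proof -
    \<comment> \<open>Restricting to the first \<open>N\<close> entries makes each set of the union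
      a cylinder over finitely many coordinates, hence open; the union over \<open>i\<close> allows
      the block of escape to depend on the orbit.\<close>
    define U where
      "U = (\<Union>i. {y \<in> topspace (seq_space X). \<forall>j\<in>{..<N} - {i..<i+K}. y j \<in> V})"
    have "openin (seq_space X) U"
      unfolding U_def by (intro openin_Union ballI)
        (auto intro!: openin_seq_space_cylinder V simp del: topspace_product_topology)
    moreover have "orbit_set X T \<subseteq> U"
    proof
      fix y assume "y \<in> orbit_set X T"
      then obtain z where z: "z \<in> topspace X" and y: "y = (\<lambda>n. (T ^^ n) z)"
        by (auto simp: orbit_set_def)
      have "y \<in> topspace (seq_space X)"
        by (simp add: y PiE_iff funpow_in_topspace[OF T z])
      then show "y \<in> U"
        using K[OF z] by (fastforce simp: U_def y)
    qed
    ultimately have "density_one {n. (seq_shift ^^ n) x \<in> U}"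
      using x by (simp add: vague_pseudo_orbit_def)
    then show ?thesis
    proof (rule density_one_mono, intro subsetI CollectI)
      fix n assume "n \<in> {n. (seq_shift ^^ n) x \<in> U}"
      then obtain i where "\<forall>j\<in>{..<N} - {i..<i+K}. x (n + j) \<in> V"
        by (auto simp: U_def funpow_seq_shift)
      then have "{j \<in> {..<N}. n + j \<notin> {n. x n \<in> V}} \<subseteq> {i..<i+K}"
        by blast
      from card_mono[OF _ this] show "card {j \<in> {..<N}. n + j \<notin> {n. x n \<in> V}} \<le> K"
        by simp
    qed
  qed
  then have "density_one {n. x n \<in> V}"
    by (rule density_one_if_sparse_windows)
  then show "density_one {n. \<rho> ((T ^^ n) p) (x n) < \<epsilon>}"
    by (rule density_one_mono) (auto simp: V_def funpow_fixpoint[of T, OF p(2)])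
qed

section \<open>Failure of weak specification\<close>

text \<open>Near an isolated point, approximate tracing is exact. Asking for \<open>q\<close> at
  time 0 and again at time \<open>M 1\<close> is a legitimate specification, because some
  \<open>z\<close> reaches \<open>q\<close> at time \<open>M 1\<close>, but a tracing point would be
  \<open>q\<close> returning to itself.\<close>

lemma not_weak_specification_if_unrepeatable:
  assumes T: "continuous_map X X T"
    and \<rho>: "compatible_metric X \<rho>"
    and q: "openin X {q}"
    and preimage: "\<And>n. \<exists>z\<in>topspace X. (T ^^ n) z = q"
    and no_return: "\<And>n. n \<ge> 1 \<Longrightarrow> (T ^^ n) q \<noteq> q"
  shows "\<not> weak_specification X T \<rho>"
proof
  assume "weak_specification X T \<rho>"
  interpret Metric_space "topspace X" \<rho>
    using \<rho> by (simp add: compatible_metric_def)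
  have "openin mtopology {q}"
    using \<rho> q by (simp add: compatible_metric_def)
  then obtain r where r: "r > 0" "mball q r \<subseteq> {q}" and q_in: "q \<in> topspace X"
    by (auto simp: openin_mtopology)
  \<comment> \<open>Tracing gives a non-strict inequality whereas balls are open, hence the
    tolerance \<open>r / 2\<close>.\<close>
  have close: "y = q" if "y \<in> topspace X" "\<rho> y q \<le> r / 2" for y
  proof -
    have "y \<in> mball q r"
      using that r(1) q_in by (simp add: commute)
    then show ?thesis using r(2) by blast
  qed
  obtain M :: "nat \<Rightarrow> nat" where M: "\<forall>n\<ge>1. M n \<ge> 1" and trace:
    "\<forall>k\<ge>1. \<forall>x (a :: nat \<Rightarrow> nat) b.
       (\<forall>i\<in>{1..k}. x i \<in> topspace X) \<and>
       (\<forall>i\<in>{1..k}. a i \<le> b i) \<and>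
       (\<forall>i\<in>{2..k}. b (i - 1) < a i) \<and>
       (\<forall>i\<in>{2..k}. a i - b (i - 1) \<ge> M (b i - a i + 1)) \<longrightarrow>
       (\<exists>y\<in>topspace X. \<forall>i\<in>{1..k}. \<forall>j\<in>{a i..b i}.
          \<rho> ((T ^^ j) y) ((T ^^ j) (x i)) \<le> r / 2)"
    using \<open>weak_specification X T \<rho>\<close> half_gt_zero[OF r(1)] unfolding weak_specification_def
    by (elim allE[of _ "r / 2"] impE exE conjE) (assumption, rule that, assumption+)
  have "M 1 \<ge> 1"
    using M by simp
  obtain z where z: "z \<in> topspace X" "(T ^^ M 1) z = q"
    using preimage by blast
  \<comment> \<open>Both segments consist of a single time, so \<open>a\<close> also serves as
    \<open>b\<close> and the required gap is exactly \<open>M 1\<close>. Positivity of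
    \<open>M 1\<close> separates the segments.\<close>
  define x where "x i = (if i = 1 then q else z)" for i :: nat
  define a where "a i = (if i = 1 then 0 else M 1)" for i :: nat
  have two: "{Suc 0..2} = {Suc 0, 2}" by auto
  obtain y where y: "y \<in> topspace X"
    "\<forall>i\<in>{1..2}. \<forall>j\<in>{a i..a i}. \<rho> ((T ^^ j) y) ((T ^^ j) (x i)) \<le> r / 2"
    using trace[rule_format, of 2 x a a] \<open>M 1 \<ge> 1\<close> q_in z(1)
    by (auto simp: two x_def a_def)
  then have "\<rho> y q \<le> r / 2" and near: "\<rho> ((T ^^ M 1) y) q \<le> r / 2"
    using z(2) by (auto simp: two x_def a_def)
  then have "y = q"
    using close y(1) by blast
  moreover have "(T ^^ M 1) y = q"
    using close[OF funpow_in_topspace[OF T y(1)] near] .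
  ultimately show False
    using no_return[OF \<open>M 1 \<ge> 1\<close>] by simp
qed

section \<open>The tent map on the dyadic points\<close>

definition dyadic_points :: "real set" where
  "dyadic_points = insert 0 (range (\<lambda>n. (1/2) ^ n))"

text \<open>The minimum of the two linear branches replaces a case distinction, so continuity is
  immediate.\<close>

definition tent :: "real \<Rightarrow> real" where
  "tent x = min (2 * x) (2 - 2 * x)"

lemma tent_power_Suc: "tent ((1/2) ^ Suc n) = (1/2) ^ n"
proof -
  have "(1/2::real) ^ n \<le> 1" by (rule power_le_one) auto
  then show ?thesis by (simp add: tent_def)
qed

lemma tent_one: "tent 1 = 0"
  by (simp add: tent_def)

lemma funpow_tent_zero: "(tent ^^ k) 0 = 0"
  by (rule funpow_fixpoint) (simp add: tent_def)

text \<open>The first application lowers the exponent by one, so induction on \<open>n\<close> with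
  \<open>k\<close> arbitrary works; the drop from 1 to 0 occurs only in the base case.\<close>

lemma funpow_tent: "(tent ^^ k) ((1/2) ^ n) = (if k \<le> n then (1/2) ^ (n - k) else 0)"
proof (induction n arbitrary: k)
  case 0
  show ?case
  proof (cases k)
    case (Suc l)
    then show ?thesis
      using tent_one by (simp add: funpow_Suc_right funpow_tent_zero del: funpow.simps)
  qed simp
next
  case (Suc n)
  show ?case
  proof (cases k)
    case (Suc l)
    then have "(tent ^^ k) ((1/2) ^ Suc n) = (tent ^^ l) ((1/2) ^ n)"
      by (simp only: funpow_Suc_right comp_apply tent_power_Suc)
    then show ?thesis
      using Suc Suc.IH[of l] by simp
  qed simp
qed

lemma continuous_map_tent:
  "continuous_map (top_of_set dyadic_points) (top_of_set dyadic_points) tent"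
proof -
  have "tent x \<in> dyadic_points" if "x \<in> dyadic_points" for x
    using that unfolding dyadic_points_def
  proof (elim insertE rangeE)
    fix n assume "x = (1/2) ^ n"
    then show "tent x \<in> insert 0 (range (\<lambda>n. (1/2) ^ n))"
      using funpow_tent[of 1 n] by (simp split: if_splits)
  qed (simp add: tent_def)
  moreover have "continuous_on dyadic_points tent"
    unfolding tent_def by (intro continuous_intros)
  ultimately show ?thesis
    by (auto simp: continuous_map_iff_continuous continuous_map_in_subtopology)
qed

lemma tds_tent: "tds (top_of_set dyadic_points) tent"
proof -
  have "(\<lambda>n. (1/2::real) ^ n) \<longlonglongrightarrow> 0"
    by (intro LIMSEQ_power_zero) simp
  then have "compact dyadic_points"
    unfolding dyadic_points_def by (rule compact_sequence_with_limit)
  then show ?thesis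
    using continuous_map_tent unfolding tds_def
    by (simp add: compact_space_subtopology metrizable_space_subtopology metrizable_space_euclidean)
qed

text \<open>Every power of 1/2 with exponent at least \<open>K\<close> lies in \<open>V\<close>.
  Along an orbit the exponent falls by one per step until the orbit reaches 0, so the exponents
  below \<open>K\<close> occupy at most \<open>K\<close> consecutive times.\<close>

lemma tent_bounded_escape:
  assumes "openin (top_of_set dyadic_points) V" "0 \<in> V"
  shows "\<exists>K. \<forall>z\<in>dyadic_points. \<exists>i. \<forall>k. k \<notin> {i..<i+K} \<longrightarrow> (tent ^^ k) z \<in> V"
proof -
  obtain e where "e > 0" and e: "ball 0 e \<inter> dyadic_points \<subseteq> V"
    using assms by (auto simp: openin_contains_ball)
  obtain K where K: "(1/2::real) ^ K < e"
    using real_arch_pow_inv[of e "1/2"] \<open>e > 0\<close> by auto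
  have V: "(1/2) ^ m \<in> V" if "K \<le> m" for m
  proof -
    have "(1/2::real) ^ m \<le> (1/2) ^ K"
      using that by (intro power_decreasing) auto
    then have "(1/2::real) ^ m < e"
      using K by (rule le_less_trans)
    then have "(1/2) ^ m \<in> ball 0 e \<inter> dyadic_points"
      by (simp add: dyadic_points_def)
    then show ?thesis
      using e by blast
  qed
  have "\<exists>i. \<forall>k. k \<notin> {i..<i+K} \<longrightarrow> (tent ^^ k) z \<in> V" if "z \<in> dyadic_points" for z
    using that unfolding dyadic_points_def
  proof (elim insertE rangeE)
    fix n assume z: "z = (1/2) ^ n"
    \<comment> \<open>Before the block the exponent \<open>n - k\<close> is still at least
      \<open>K\<close>, after it the orbit is at 0. If \<open>K > n + 1\<close>, truncated
      subtraction starts the block at 0, and it still covers all times up to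
      \<open>n\<close>.\<close>
    have "(tent ^^ k) z \<in> V" if "k \<notin> {n + 1 - K..<n + 1 - K + K}" for k
      using that assms(2) unfolding z funpow_tent by (auto intro!: V)
    then show ?thesis by blast
  qed (simp add: funpow_tent_zero assms(2))
  then show ?thesis by blast
qed

theorem corollary7p10:
  shows "\<exists>(X :: real topology) (T :: real \<Rightarrow> real).
           tds X T \<and>
           (\<forall>\<rho>. compatible_metric X \<rho> \<longrightarrow>
              vague_specification X T \<rho> \<and> \<not> weak_specification X T \<rho>)"
proof (intro exI conjI allI impI)
  let ?X = "top_of_set dyadic_points"
  show "tds ?X tent"
    by (rule tds_tent)
  fix \<rho> assume \<rho>: "compatible_metric ?X \<rho>"
  show "vague_specification ?X tent \<rho>"
  proof (rule vague_specification_if_bounded_escape[OF continuous_map_tent \<rho>])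
    show "0 \<in> topspace ?X" "tent 0 = 0"
      by (auto simp: dyadic_points_def tent_def)
  qed (use tent_bounded_escape in simp)
  show "\<not> weak_specification ?X tent \<rho>"
  proof (rule not_weak_specification_if_unrepeatable[OF continuous_map_tent \<rho>])
    \<comment> \<open>All points other than 1 are at most 1/2, so an open half-line isolates
      1.\<close>
    have "(1/2) ^ n \<le> (1/2::real)" if "n > 0" for n
      using that power_decreasing[of 1 n "1/2::real"] by simp
    then have "n = 0" if "(1/2) ^ n > (1/2::real)" for n
      using that by (meson gr0I not_less)
    then have "x = 1" if "x \<in> dyadic_points" "x > 1/2" for x
      using that unfolding dyadic_points_def by (elim insertE rangeE) (simp, metis power_0)
    moreover have "1 \<in> dyadic_points"
      unfolding dyadic_points_def by (intro insertI2 range_eqI[of _ _ 0]) simp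
    ultimately have "{1} = dyadic_points \<inter> {1/2<..}"
      by auto
    then show "openin ?X {1}"
      by (simp add: openin_open_Int)
    show "\<exists>z\<in>topspace ?X. (tent ^^ n) z = 1" for n
      by (rule bexI[of _ "(1/2) ^ n"]) (auto simp: funpow_tent dyadic_points_def)
    show "(tent ^^ n) 1 \<noteq> 1" if "n \<ge> 1" for n
      using funpow_tent[of n 0] that by simp
  qed
qed

end
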